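(* Let $n$ be a positive integer. There is a bijection between the set of extremely lucky Stirling permutations of order $n$ and the set of valid parenthesizations of $n$ pairs of parentheses.
   Context: A Stirling permutation of order $n$ is a permutation $w = w(1)w(2)\cdots w(2n)$ of the multiset $\{1,1,2,2,\ldots,n,n\}$ such that any value $j$ appearing between the two instances of $i$ satisfies $j>i$. $Q_n$ denotes the set of Stirling permutations of order $n$. Parking interpretation: there is a one-way street with spots $1,\ldots,2n$ (in this order), and cars $1,2,\ldots,2n$ arrive in order, car $i$ having preferred spot $w(i)$. Car $i$ parks in spot $w(i)$ if it is available; otherwise it continues down the street and parks in the first available spot after $w(i)$. For every $w\in Q_n$ all cars park. Car $i$ is lucky if it parks in its preferred spot $w(i)$, and unlucky otherwise. $\mathrm{lucky}(w)$ denotes the number of lucky cars of $w$. A Stirling permutation $w\in Q_n$ is extremely lucky if $\mathrm{lucky}(w)=n$. A valid parenthesization of $n$ pairs of parentheses is a string of $n$ symbols "(" and $n$ symbols ")" that is correctly matched (every prefix contains at least as many "(" as ")"). *)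

theory Defs
  imports Main "HOL-Library.Multiset"
begin

text \<open>Words are lists, so the letter \<open>w(i)\<close> is \<open>w ! (i - 1)\<close>; the values of the letters,
  and hence the parking spots, are numbered from 1.\<close>

definition stirling_perms :: "nat \<Rightarrow> nat list set" where
  "stirling_perms n =
    {w. mset w = (\<Sum>i\<in>{1..n}. {#i, i#}) \<and>
        (\<forall>a b c. a < b \<longrightarrow> b < c \<longrightarrow> c < length w \<longrightarrow> w ! a = w ! c \<longrightarrow> w ! b > w ! a)}"

text \<open>The spot taken by a car with preference \<open>p\<close> on a street with spots \<open>1, \<dots>, m\<close>, of which
  those in \<open>occ\<close> are taken; \<^term>\<open>None\<close> if the car reaches the end of the street without parking.\<close>

definition park_spot :: "nat \<Rightarrow> nat set \<Rightarrow> nat \<Rightarrow> nat option" where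
  "park_spot m occ p =
    (if \<exists>q\<in>{p..m}. q \<notin> occ then Some (LEAST q. q \<in> {p..m} \<and> q \<notin> occ) else None)"

fun park_all :: "nat \<Rightarrow> nat set \<Rightarrow> nat list \<Rightarrow> nat option list" where
  "park_all m occ [] = []"
| "park_all m occ (p # ps) =
    (let s = park_spot m occ p in s # park_all m (occ \<union> set_option s) ps)"

definition outcome :: "nat list \<Rightarrow> nat option list" where
  "outcome w = park_all (length w) {} w"

definition lucky :: "nat list \<Rightarrow> nat" where
  "lucky w = card {i. i < length w \<and> outcome w ! i = Some (w ! i)}"

definition extremely_lucky :: "nat \<Rightarrow> nat list set" where
  "extremely_lucky n = {w \<in> stirling_perms n. lucky w = n}"

datatype paren = Open | Close

definition valid_parens :: "nat \<Rightarrow> paren list set" where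
  "valid_parens n =
    {s. count_list s Open = n \<and> count_list s Close = n \<and>
        (\<forall>k\<le>length s. count_list (take k s) Close \<le> count_list (take k s) Open)}"

end

theory Submission
  imports Defs
begin

text \<open>The second car preferring \<open>i\<close> never gets spot \<open>i\<close>, so \<open>w\<close> is extremely lucky iff the
  first car preferring each value is lucky, i.e. iff the second cars all park beyond \<open>n\<close>. This
  happens iff every letter after both copies of \<open>i\<close> is smaller than \<open>i\<close>. Together with the Stirling
  condition, the word has the shape \<open>A m B m\<close>, with \<open>m\<close> the least letter and all letters of \<open>A\<close>
  larger than those of \<open>B\<close>. So the labels are forced by the underlying binary tree, just as in the
  decomposition \<open>A ( B )\<close> of a balanced string.\<close>

subsection \<open>Binary trees and balanced strings\<close>

datatype btree = Leaf | Node btree btree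

fun parens :: "btree \<Rightarrow> paren list" where
  "parens Leaf = []"
| "parens (Node l r) = parens l @ Open # parens r @ [Close]"

text \<open>A shift-reduce parser. The stack holds one tree per bracket level currently open,
  innermost first. The last clause is a default for a \<open>Close\<close> that matches no
  \<open>Open\<close>.\<close>

fun parse :: "btree list \<Rightarrow> paren list \<Rightarrow> btree list" where
  "parse st [] = st"
| "parse st (Open # s) = parse (Leaf # st) s"
| "parse (r # l # st) (Close # s) = parse (Node l r # st) s"
| "parse st (Close # s) = []"

text \<open>The part of the input already consumed when the parser has reached a given stack.\<close>

fun consumed :: "btree list \<Rightarrow> paren list" where
  "consumed [] = []"
| "consumed [t] = parens t"
| "consumed (t # st) = consumed st @ Open # parens t"

text \<open>Makes \<open>parse [Leaf]\<close> a left inverse of \<open>parens\<close>, up to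
  wrapping in a one-element list. The rest \<open>s\<close> and the stack \<open>st\<close> are kept
  general because the code of a subtree is read in the middle of a run.\<close>

lemma parse_parens: "parse (Leaf # st) (parens t @ s) = parse (t # st) s"
  by (induction t arbitrary: st s) auto

lemma inj_parens: "inj parens"
proof (rule injI)
  fix t u assume "parens t = parens u"
  then have "parse [Leaf] (parens t @ []) = parse [Leaf] (parens u @ [])" by simp
  then show "t = u" unfolding parse_parens by simp
qed

text \<open>\<open>Open\<close> pushes one tree and \<open>Close\<close> removes one, so the
  hypothesis on prefixes keeps the stack nonempty and the default clause is never reached. For
  balanced input the length equation leaves a single tree.\<close>

lemma parse_correct:
  assumes "st \<noteq> []"
    and "\<And>k. count_list (take k s) Close < count_list (take k s) Open + length st"
  shows "consumed (parse st s) = consumed st @ s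
    \<and> length (parse st s) + count_list s Close = length st + count_list s Open"
  using assms
proof (induction st s rule: parse.induct)
  case (2 st s)
  have "count_list (take k s) Close < count_list (take k s) Open + length (Leaf # st)" for k
    using 2(3)[of "Suc k"] by simp
  then show ?case using 2(1,2) by (cases st) auto
next
  case (3 r l st s)
  have "count_list (take k s) Close < count_list (take k s) Open + length (Node l r # st)" for k
    using 3(3)[of "Suc k"] by simp
  then show ?case using 3(1) by (cases st) auto
next
  \<comment> \<open>A \<open>Close\<close> on a one-element stack violates the hypothesis already
    for the prefix of length 1.\<close>
  case ("4_2" v s)
  then show ?case using "4_2"(2)[of 1] by simp
qed auto

lemma count_list_parens:
  "count_list (parens t) Open = size t" "count_list (parens t) Close = size t"
  by (induction t) auto

lemma parens_prefix:
  "count_list (take k (parens t)) Close \<le> count_list (take k (parens t)) Open"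
proof (induction t arbitrary: k)
  case (Node l r)
  have "count_list (take j (Open # parens r @ [Close])) Close
      \<le> count_list (take j (Open # parens r @ [Close])) Open" for j
  proof (cases j)
    case (Suc i)
    \<comment> \<open>The final \<open>Close\<close> is paid for by the leading
      \<open>Open\<close>.\<close>
    have tail: "count_list (take d [Close]) Close \<le> 1" for d by (cases d) auto
    show ?thesis
      using Suc Node.IH(2)[of i] tail[of "i - length (parens r)"] by simp
  qed simp
  then show ?case using Node.IH(1)[of k] by (simp add: add_mono)
qed simp

lemma bij_betw_parens: "bij_betw parens {t. size t = n} (valid_parens n)"
  unfolding bij_betw_def
proof (intro conjI)
  show "inj_on parens {t. size t = n}"
    using inj_parens by (rule inj_on_subset) simp
  show "parens ` {t. size t = n} = valid_parens n"
  proof (intro equalityI subsetI)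
    fix s assume "s \<in> parens ` {t. size t = n}"
    then show "s \<in> valid_parens n"
      by (auto simp: valid_parens_def count_list_parens parens_prefix)
  next
    fix s assume s: "s \<in> valid_parens n"
    \<comment> \<open>For \<open>k\<close> beyond the length the prefix is all of \<open>s\<close>,
      whose two counts agree.\<close>
    have "count_list (take k s) Close \<le> count_list (take k s) Open" for k
      using s by (cases "k \<le> length s") (auto simp: valid_parens_def)
    then have *: "consumed (parse [Leaf] s) = s" "length (parse [Leaf] s) = 1"
      using parse_correct[of "[Leaf]" s] s by (auto simp: valid_parens_def le_imp_less_Suc)
    then obtain t where "parse [Leaf] s = [t]" by (auto simp: length_Suc_conv)
    with * have "parens t = s" by simp
    moreover from this have "size t = n" using s
      by (auto simp: valid_parens_def count_list_parens)
    ultimately show "s \<in> parens ` {t. size t = n}" by auto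
  qed
qed

subsection \<open>Binary trees and nested words\<close>

text \<open>A single decomposition per letter encodes three facts: the letter occurs exactly twice,
  the Stirling condition holds between its copies, and only smaller letters follow them.\<close>

definition nested :: "nat list \<Rightarrow> bool" where
  "nested w \<longleftrightarrow> (\<forall>i\<in>set w. \<exists>x y z. w = x @ i # y @ i # z \<and> i \<notin> set x
      \<and> (\<forall>j\<in>set y. i < j) \<and> (\<forall>j\<in>set z. j < i))"

lemma nestedE:
  assumes "nested w" "i \<in> set w"
  obtains x y z where "w = x @ i # y @ i # z" "i \<notin> set x"
    "\<forall>j\<in>set y. i < j" "\<forall>j\<in>set z. j < i"
  using bspec[OF assms(1)[unfolded nested_def] assms(2)] that by blast

text \<open>The only labelling that can be nested: the root takes the least label, the right subtree
  the next \<open>size r\<close> labels, and the left subtree, whose letters come first, all the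
  larger ones.\<close>

fun word :: "nat \<Rightarrow> btree \<Rightarrow> nat list" where
  "word m Leaf = []"
| "word m (Node l r) = word (Suc m + size r) l @ m # word (Suc m) r @ [m]"

lemma set_word: "set (word m t) = {m..<m + size t}"
  by (induction t arbitrary: m) auto

lemma nested_word: "nested (word m t)"
proof (induction t arbitrary: m)
  case (Node l r)
  let ?A = "word (Suc m + size r) l" and ?B = "word (Suc m) r"
  show ?case unfolding nested_def
  proof
    fix i assume "i \<in> set (word m (Node l r))"
    then consider "i = m" | "i \<in> set ?A" | "i \<in> set ?B" by auto
    then show "\<exists>x y z. word m (Node l r) = x @ i # y @ i # z \<and> i \<notin> set x
      \<and> (\<forall>j\<in>set y. i < j) \<and> (\<forall>j\<in>set z. j < i)"
    proof cases
      case 1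
      show ?thesis
        by (rule exI[of _ ?A], rule exI[of _ ?B], rule exI[of _ "[]"])
          (use 1 in \<open>auto simp: set_word\<close>)
    next
      case 2
      then obtain x y z where "?A = x @ i # y @ i # z" "i \<notin> set x"
        "\<forall>j\<in>set y. i < j" "\<forall>j\<in>set z. j < i"
        using Node.IH(1) unfolding nested_def by blast
      note xyz = this
      show ?thesis
        by (rule exI[of _ x], rule exI[of _ y], rule exI[of _ "z @ m # ?B @ [m]"])
          (use 2 xyz in \<open>auto simp: set_word\<close>)
    next
      case 3
      then obtain x y z where "?B = x @ i # y @ i # z" "i \<notin> set x"
        "\<forall>j\<in>set y. i < j" "\<forall>j\<in>set z. j < i"
        using Node.IH(2) unfolding nested_def by blast
      moreover have "i \<in> {Suc m..<Suc m + size r}" using 3 by (simp add: set_word)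
      ultimately have xyz: "?B = x @ i # y @ i # z" "i \<notin> set x"
        "\<forall>j\<in>set y. i < j" "\<forall>j\<in>set z. j < i" "i \<notin> set ?A" "m < i"
        by (auto simp: set_word)
      show ?thesis
        by (rule exI[of _ "?A @ m # x"], rule exI[of _ y], rule exI[of _ "z @ [m]"])
          (use xyz in auto)
    qed
  qed
qed (simp add: nested_def)

lemma inj_word: "word m t = word m u \<Longrightarrow> t = u"
proof (induction t arbitrary: m u)
  case Leaf
  then show ?case by (cases u) auto
next
  case (Node l r)
  then obtain l' r' where u: "u = Node l' r'" by (cases u) auto
  have "word (Suc m + size r) l @ m # word (Suc m) r
      = word (Suc m + size r') l' @ m # word (Suc m) r'"
    using Node.prems u by simp
  \<comment> \<open>\<open>m\<close> occurs in none of the subwords, so it separates both sides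
    uniquely.\<close>
  then have eq: "word (Suc m + size r) l = word (Suc m + size r') l'"
      "word (Suc m) r = word (Suc m) r'"
    by (subst (asm) append_Cons_eq_iff; auto simp: set_word)+
  \<comment> \<open>The right subtrees must be identified first: only then do the left words start
    at the same label, as their induction hypothesis requires.\<close>
  then have "r = r'" using Node.IH(2) by blast
  with eq Node.IH(1) u show ?case by blast
qed

section \<open>Recovering the tree from a nested word\<close>

text \<open>Turns the comparison between the letters of \<open>A\<close> and \<open>B\<close> into
  the consecutive label ranges that \<open>word\<close> uses.\<close>

lemma interval_split:
  fixes X Y :: "nat set"
  assumes "X \<union> Y = {l..<u}" "\<And>x y. x \<in> X \<Longrightarrow> y \<in> Y \<Longrightarrow> y < x" "l \<le> u"
  obtains k where "Y = {l..<k}" "X = {k..<u}" "l \<le> k" "k \<le> u"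
proof
  have fin: "finite X" using assms(1) by (metis finite_Un finite_atLeastLessThan)
  \<comment> \<open>The cut is the least element of \<open>X\<close>; inserting \<open>u\<close>
    handles empty \<open>X\<close>.\<close>
  let ?k = "Min (insert u X)"
  have mem: "x \<in> X \<or> x \<in> Y \<longleftrightarrow> l \<le> x \<and> x < u" for x
    using assms(1) by (metis Un_iff atLeastLessThan_iff)
  have lt: "x < ?k \<longleftrightarrow> x < u \<and> (\<forall>y\<in>X. x < y)" for x using fin by auto
  have ge: "l \<le> ?k" using fin mem assms(3) by (subst Min_ge_iff) blast+
  show "Y = {l..<?k}"
  proof (intro set_eqI)
    fix x show "x \<in> Y \<longleftrightarrow> x \<in> {l..<?k}"
      unfolding atLeastLessThan_iff lt using mem[of x] assms(2) by (metis less_irrefl)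
  qed
  show "X = {?k..<u}"
  proof (intro set_eqI iffI)
    fix x assume "x \<in> X"
    then show "x \<in> {?k..<u}" using mem fin by auto
  next
    fix x assume x: "x \<in> {?k..<u}"
    have "x \<notin> Y"
      using x mem assms(2) lt by (metis atLeastLessThan_iff not_less)
    moreover have "l \<le> x" using x ge by auto
    ultimately show "x \<in> X" using mem[of x] x by simp
  qed
  show "l \<le> ?k" by (rule ge)
  show "?k \<le> u" using fin by simp
qed

lemma nested_split:
  assumes w: "nested w" "m \<in> set w" "\<And>j. j \<in> set w \<Longrightarrow> m \<le> j"
  obtains A B where "w = A @ m # B @ [m]" "m \<notin> set A" "m \<notin> set B" "nested A" "nested B"
    "\<And>i j. i \<in> set A \<Longrightarrow> j \<in> set B \<Longrightarrow> j < i"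
proof -
  obtain A B z where *: "w = A @ m # B @ m # z" "m \<notin> set A"
      "\<forall>j\<in>set B. m < j" "\<forall>j\<in>set z. j < m"
    using w(1,2) unfolding nested_def by blast
  \<comment> \<open>Letters after the second \<open>m\<close> would be smaller than the
    minimum.\<close>
  have "z = []" using * w(3) by (cases z) force+
  then have weq: "w = A @ m # B @ [m]" using * by simp
  have mB: "m \<notin> set B" using * by blast
  \<comment> \<open>No pair of copies of \<open>j\<close> straddles the first \<open>m\<close>: a
    letter between them exceeds \<open>j\<close>, which the minimum cannot. So the pair lies wholly
    in \<open>A\<close> or wholly in \<open>B\<close>.\<close>
  have shape: "(\<exists>z'. A = x @ j # y @ j # z' \<and> z = z' @ m # B @ [m])
      \<or> (\<exists>x' z'. B = x' @ j # y @ j # z' \<and> x = A @ m # x' \<and> z = z' @ [m])"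
    if "w = x @ j # y @ j # z" "j \<in> set w" "j \<noteq> m" "\<forall>i\<in>set y. j < i" for x y z j
  proof -
    have last: "last w = m" using weq by simp
    have "z \<noteq> []" using last that(1,3) by auto
    moreover from this have "last z = m" using last that(1) by simp
    ultimately obtain z1 where z1: "z = z1 @ [m]" by (metis append_butlast_last_id)
    have eq: "A @ m # B = x @ j # y @ j # z1" using that(1) weq z1 by simp
    have "m \<notin> set y" using that w(3) by (metis not_less)
    moreover have "m \<in> set (x @ j # y @ j # z1)" by (simp flip: eq)
    ultimately have "m \<in> set x \<or> m \<in> set z1" using that(3) by auto
    then show ?thesis
    proof
      assume "m \<in> set x"
      then obtain x1 x2 where "x = x1 @ m # x2" by (meson split_list)
      with eq have "A @ m # B = x1 @ m # (x2 @ j # y @ j # z1)" by simp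
      then have "A = x1 \<and> B = x2 @ j # y @ j # z1" using *(2) mB
        by (subst (asm) append_Cons_eq_iff)
      with \<open>x = x1 @ m # x2\<close> z1 show ?thesis by simp
    next
      assume "m \<in> set z1"
      then obtain x1 x2 where "z1 = x1 @ m # x2" by (meson split_list)
      with eq have "A @ m # B = (x @ j # y @ j # x1) @ m # x2" by simp
      then have "A = x @ j # y @ j # x1 \<and> B = x2" using *(2) mB
        by (subst (asm) append_Cons_eq_iff)
      with \<open>z1 = x1 @ m # x2\<close> z1 show ?thesis by simp
    qed
  qed
  \<comment> \<open>For a pair inside \<open>A\<close>, the whole of \<open>B\<close> comes after
    the second copy, so its letters are smaller; this gives the order between \<open>A\<close> and
    \<open>B\<close>.\<close>
  have inA: "\<exists>x y z. A = x @ j # y @ j # z \<and> j \<notin> set x \<and> (\<forall>i\<in>set y. j < i)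
      \<and> (\<forall>i\<in>set z. i < j) \<and> (\<forall>i\<in>set B. i < j)" if "j \<in> set A" for j
  proof -
    have j: "j \<in> set w" "j \<noteq> m" using that weq *(2) by auto
    then obtain x y z where "w = x @ j # y @ j # z" "j \<notin> set x" "\<forall>i\<in>set y. j < i" "\<forall>i\<in>set z. i < j"
      using w(1) unfolding nested_def by blast
    moreover from this shape[of x j y z] j that obtain z' where "A = x @ j # y @ j # z'" "z = z' @ m # B @ [m]"
      using weq by auto
    ultimately have "A = x @ j # y @ j # z' \<and> j \<notin> set x \<and> (\<forall>i\<in>set y. j < i)
        \<and> (\<forall>i\<in>set z'. i < j) \<and> (\<forall>i\<in>set B. i < j)" by auto
    then show ?thesis by blast
  qed
  have inB: "\<exists>x y z. B = x @ j # y @ j # z \<and> j \<notin> set x \<and> (\<forall>i\<in>set y. j < i)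
      \<and> (\<forall>i\<in>set z. i < j)" if "j \<in> set B" for j
  proof -
    have j: "j \<in> set w" "j \<noteq> m" using that weq mB by auto
    then obtain x y z where "w = x @ j # y @ j # z" "j \<notin> set x" "\<forall>i\<in>set y. j < i" "\<forall>i\<in>set z. i < j"
      using w(1) unfolding nested_def by blast
    moreover from this shape[of x j y z] j that obtain x' z'
      where "B = x' @ j # y @ j # z'" "x = A @ m # x'" "z = z' @ [m]"
      using weq by auto
    ultimately have "B = x' @ j # y @ j # z' \<and> j \<notin> set x' \<and> (\<forall>i\<in>set y. j < i)
        \<and> (\<forall>i\<in>set z'. i < j)" by auto
    then show ?thesis by blast
  qed
  show thesis
    using that[OF weq *(2) mB] inA inB unfolding nested_def by blast
qed

text \<open>Induction on the length: splitting at the least letter leaves two shorter nested words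
  whose letters again form intervals, with other starting labels, hence the general \<open>m\<close>
  and \<open>n\<close>.\<close>

lemma nested_imp_word:
  "nested w \<Longrightarrow> set w = {m..<m + n} \<Longrightarrow> \<exists>t. size t = n \<and> word m t = w"
proof (induction "length w" arbitrary: w m n rule: less_induct)
  case less
  show ?case
  proof (cases n)
    case 0
    then have "size Leaf = n \<and> word m Leaf = w" using less.prems by simp
    then show ?thesis by blast
  next
    case (Suc n')
    have "m \<in> set w" "\<And>j. j \<in> set w \<Longrightarrow> m \<le> j" using less.prems(2) Suc by auto
    from nested_split[OF less.prems(1) this] obtain A B
      where AB: "w = A @ m # B @ [m]" "m \<notin> set A" "m \<notin> set B" "nested A" "nested B"
        "\<And>i j. i \<in> set A \<Longrightarrow> j \<in> set B \<Longrightarrow> j < i" by blast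
    have "set A \<union> set B = set w - {m}" using AB by auto
    also have "\<dots> = {Suc m..<m + n}" unfolding less.prems(2) by auto
    finally have "set A \<union> set B = {Suc m..<m + n}" .
    moreover have "Suc m \<le> m + n" using Suc by simp
    ultimately obtain k where k: "set B = {Suc m..<k}" "set A = {k..<m + n}"
      "Suc m \<le> k" "k \<le> m + n"
      using interval_split[of "set A" "set B" "Suc m" "m + n"] AB(6) by blast
    obtain r where r: "size r = k - Suc m" "word (Suc m) r = B"
      using less.hyps[of B "Suc m" "k - Suc m"] AB(1,5) k(1,3) by auto
    obtain l where l: "size l = m + n - k" "word k l = A"
      using less.hyps[of A k "m + n - k"] AB(1,4) k(2,4) by auto
    have "size (Node l r) = n" "word m (Node l r) = w" using r l AB(1) k(3,4) by auto
    then show ?thesis by blast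
  qed
qed

lemma bij_betw_word: "bij_betw (word m) {t. size t = n} {w. nested w \<and> set w = {m..<m + n}}"
  unfolding bij_betw_def
proof (intro conjI equalityI subsetI)
  show "inj_on (word m) {t. size t = n}" by (rule inj_onI) (rule inj_word)
  show "w \<in> {w. nested w \<and> set w = {m..<m + n}}" if "w \<in> word m ` {t. size t = n}" for w
    using that by (auto simp: nested_word set_word)
  show "w \<in> word m ` {t. size t = n}" if "w \<in> {w. nested w \<and> set w = {m..<m + n}}" for w
    using that nested_imp_word[of w m n] by (metis (mono_tags, lifting) image_eqI mem_Collect_eq)
qed

subsection \<open>Parking\<close>

text \<open>The street as seen by car \<open>k\<close> on arrival, with cars indexed from 0 but
  spots from 1.\<close>

definition taken :: "nat list \<Rightarrow> nat \<Rightarrow> nat set" where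
  "taken w k = (\<Union>s\<in>set (take k (outcome w)). set_option s)"

lemma length_park_all: "length (park_all m occ ps) = length ps"
  by (induction ps arbitrary: occ) (auto simp: Let_def)

lemma length_outcome: "length (outcome w) = length w"
  by (simp add: outcome_def length_park_all)

lemma park_all_nth:
  "k < length ps \<Longrightarrow> park_all m occ ps ! k
    = park_spot m (occ \<union> (\<Union>s\<in>set (take k (park_all m occ ps)). set_option s)) (ps ! k)"
proof (induction ps arbitrary: occ k)
  case (Cons p ps)
  then show ?case by (cases k) (simp_all add: Let_def Un_assoc)
qed simp

lemma outcome_nth:
  "k < length w \<Longrightarrow> outcome w ! k = park_spot (length w) (taken w k) (w ! k)"
  unfolding taken_def outcome_def by (subst park_all_nth) simp_all

lemma taken_Suc:
  "k < length w \<Longrightarrow> taken w (Suc k) = taken w k \<union> set_option (outcome w ! k)"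
  by (simp add: taken_def take_Suc_conv_app_nth length_outcome Un_commute)

lemma taken_mono: "j \<le> k \<Longrightarrow> taken w j \<subseteq> taken w k"
  unfolding taken_def by (intro UN_mono set_take_subset_set_take) auto

lemma in_takenI:
  assumes "outcome w ! j = Some s" "j < k" "k \<le> length w"
  shows "s \<in> taken w k"
  using taken_Suc[of j w] taken_mono[of "Suc j" k w] assms by auto

lemma park_spot_eq_SomeD:
  assumes "park_spot m occ p = Some s"
  shows "p \<le> s" "s \<le> m" "s \<notin> occ" "\<And>q. p \<le> q \<Longrightarrow> q < s \<Longrightarrow> q \<in> occ"
proof -
  let ?P = "\<lambda>q. q \<in> {p..m} \<and> q \<notin> occ"
  have ex: "\<exists>q. ?P q" and s: "s = (LEAST q. ?P q)"
    using assms by (auto simp: park_spot_def split: if_splits)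
  have P: "?P s" using LeastI_ex[OF ex] s by simp
  then show "p \<le> s" "s \<le> m" "s \<notin> occ" by auto
  show "q \<in> occ" if "p \<le> q" "q < s" for q
    using not_less_Least[of q ?P] that P s by auto
qed

lemma park_spot_self_iff: "park_spot m occ p = Some p \<longleftrightarrow> p \<le> m \<and> p \<notin> occ"
proof
  assume "p \<le> m \<and> p \<notin> occ"
  then show "park_spot m occ p = Some p"
    by (auto simp: park_spot_def intro!: Least_equality)
qed (use park_spot_eq_SomeD in blast)

section \<open>Lucky cars and first occurrences of values\<close>

definition lucky_cars :: "nat list \<Rightarrow> nat set" where
  "lucky_cars w = {k. k < length w \<and> outcome w ! k = Some (w ! k)}"

definition first_cars :: "nat list \<Rightarrow> nat set" where
  "first_cars w = {k. k < length w \<and> (\<forall>j<k. w ! j \<noteq> w ! k)}"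

lemma lucky_cars_iff:
  "k \<in> lucky_cars w \<longleftrightarrow> k < length w \<and> w ! k \<le> length w \<and> w ! k \<notin> taken w k"
  by (auto simp: lucky_cars_def outcome_nth park_spot_self_iff)

text \<open>A spot still free for car \<open>k\<close> was free for every earlier car; one with the
  same preference would have taken it.\<close>

lemma lucky_cars_subset: "lucky_cars w \<subseteq> first_cars w"
proof
  fix k assume k: "k \<in> lucky_cars w"
  have "w ! j \<noteq> w ! k" if "j < k" for j
  proof
    assume eq: "w ! j = w ! k"
    have "w ! k \<notin> taken w j" using k that taken_mono[of j k w] by (auto simp: lucky_cars_iff)
    then have "j \<in> lucky_cars w" using k that eq by (auto simp: lucky_cars_iff)
    then have "w ! k \<in> taken w k"
      using in_takenI[of w j "w ! k" k] k that eq by (auto simp: lucky_cars_def)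
    then show False using k by (simp add: lucky_cars_iff)
  qed
  then show "k \<in> first_cars w" using k by (auto simp: first_cars_def lucky_cars_def)
qed

lemma first_carE:
  assumes "v \<in> set w"
  obtains k where "k \<in> first_cars w" "w ! k = v"
proof -
  let ?P = "\<lambda>k. k < length w \<and> w ! k = v"
  have ex: "\<exists>k. ?P k" using assms unfolding in_set_conv_nth by blast
  have "?P (LEAST k. ?P k)" using LeastI_ex[of ?P, OF ex] .
  moreover have "\<not> ?P j" if "j < (LEAST k. ?P k)" for j using not_less_Least[of j ?P] that by blast
  moreover define k where "k = (LEAST k. ?P k)"
  ultimately have "?P k" "\<And>j. j < k \<Longrightarrow> \<not> ?P j" by blast+
  then have "k \<in> first_cars w" unfolding first_cars_def by (auto dest: less_trans)
  with \<open>?P k\<close> that show thesis by blast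
qed

lemma bij_betw_first_cars: "bij_betw ((!) w) (first_cars w) (set w)"
  unfolding bij_betw_def
proof (intro conjI)
  show "inj_on ((!) w) (first_cars w)"
  proof (rule inj_onI)
    fix j k assume "j \<in> first_cars w" "k \<in> first_cars w" "w ! j = w ! k"
    then have "\<not> j < k" "\<not> k < j" unfolding first_cars_def by auto
    then show "j = k" by simp
  qed
  show "(!) w ` first_cars w = set w"
  proof (intro equalityI subsetI)
    fix v assume "v \<in> (!) w ` first_cars w"
    then show "v \<in> set w" by (auto simp: first_cars_def)
  next
    fix v assume "v \<in> set w"
    then show "v \<in> (!) w ` first_cars w" using first_carE[of v w] by blast
  qed
qed

text \<open>Each value has exactly one first car, so by the inclusion above equality of
  cardinalities amounts to equality of sets.\<close>

lemma lucky_eq_iff: "lucky w = card (set w) \<longleftrightarrow> lucky_cars w = first_cars w"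
proof -
  have "finite (first_cars w)" by (simp add: first_cars_def)
  moreover have "card (first_cars w) = card (set w)"
    using bij_betw_first_cars by (rule bij_betw_same_card)
  moreover have "lucky w = card (lucky_cars w)" by (simp add: lucky_def lucky_cars_def)
  ultimately show ?thesis
    using lucky_cars_subset[of w] by (metis card_subset_eq)
qed

section \<open>Extreme luck as an order condition on letters\<close>

definition stirling_word :: "nat list \<Rightarrow> bool" where
  "stirling_word w \<longleftrightarrow>
    (\<forall>a b c. a < b \<longrightarrow> b < c \<longrightarrow> c < length w \<longrightarrow> w ! a = w ! c \<longrightarrow> w ! b > w ! a)"

definition descending_after :: "nat list \<Rightarrow> bool" where
  "descending_after w \<longleftrightarrow>
    (\<forall>a b c. a < b \<longrightarrow> b < c \<longrightarrow> c < length w \<longrightarrow> w ! a = w ! b \<longrightarrow> w ! c < w ! a)"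

text \<open>Suppose a letter \<open>w ! c\<close> at least as large follows the second copy at
  \<open>b\<close>. If its spot is still free when \<open>b\<close> arrives, \<open>b\<close> parks
  at some \<open>s\<close> in \<open>{1..n}\<close>, a spot which the first car preferring
  \<open>s\<close> also gets by being lucky.\<close>

lemma descending_after_if_lucky:
  assumes set: "set w = {1..n}" and S: "stirling_word w"
    and lucky: "lucky_cars w = first_cars w"
  shows "descending_after w"
  unfolding descending_after_def
proof (intro allI impI)
  fix a b c assume abc: "a < b" "b < c" "c < length w" "w ! a = w ! b"
  show "w ! c < w ! a"
  proof (rule ccontr)
    assume "\<not> w ! c < w ! a"
    then have ge: "w ! b \<le> w ! c" using abc by simp
    obtain d where d: "d \<in> first_cars w" "w ! d = w ! c"
      using first_carE[of "w ! c" w] abc by auto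
    have unlucky: "b \<notin> lucky_cars w" using lucky abc by (auto simp: first_cars_def)
    have "d < b"
    proof (rule ccontr)
      assume "\<not> d < b"
      moreover have "d \<in> lucky_cars w" using d lucky by simp
      ultimately have free: "w ! c \<notin> taken w b" "w ! c \<le> length w"
        using d(2) taken_mono[of b d w] by (auto simp: lucky_cars_iff)
      then have "\<exists>q\<in>{w ! b..length w}. q \<notin> taken w b" using ge by auto
      then obtain s where s: "outcome w ! b = Some s"
        using abc by (simp add: outcome_nth park_spot_def)
      then have spot: "park_spot (length w) (taken w b) (w ! b) = Some s"
        using abc by (simp add: outcome_nth)
      then have "s \<le> w ! c"
        using park_spot_eq_SomeD(4)[OF spot ge] free by (meson not_less)
      moreover have "w ! b \<le> s" using park_spot_eq_SomeD(1)[OF spot] .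
      moreover have "w ! b \<in> set w" "w ! c \<in> set w" using abc by auto
      ultimately have "s \<in> set w" using set by auto
      then obtain e where e: "e \<in> lucky_cars w" "w ! e = s"
        using first_carE[of s w] lucky by auto
      then have "e \<noteq> b" using unlucky by blast
      \<comment> \<open>Whichever of \<open>b\<close> and \<open>e\<close> comes later finds
        \<open>s\<close> occupied.\<close>
      then consider "e < b" | "b < e" by linarith
      then show False
      proof cases
        case 1
        then have "s \<in> taken w b" using in_takenI[of w e s b] e abc by (simp add: lucky_cars_def)
        then show False using park_spot_eq_SomeD(3)[OF spot] by simp
      next
        case 2
        then have "s \<in> taken w e" using in_takenI[OF s, of e] e by (simp add: lucky_cars_def)
        then show False using e by (simp add: lucky_cars_iff)
      qed
    qed
    \<comment> \<open>Now \<open>b\<close> lies between the equal letters at \<open>d\<close> and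
      \<open>c\<close>, so the Stirling condition applies.\<close>
    then have "w ! b > w ! d" using S d abc unfolding stirling_word_def by blast
    then show False using ge d by simp
  qed
qed

lemma in_set_take_conv_nth: "k \<le> length w \<Longrightarrow> v \<in> set (take k w) \<longleftrightarrow> (\<exists>i<k. w ! i = v)"
  by (auto simp flip: nth_image)

text \<open>Cars repeating a preference never park in \<open>{1..n}\<close>, so there the occupied
  spots are exactly the values read so far, and every first car finds its spot free.\<close>

lemma lucky_if_descending_after:
  assumes set: "set w = {1..n}" and n: "n \<le> length w" and D: "descending_after w"
  shows "lucky_cars w = first_cars w"
proof -
  have taken: "taken w k \<inter> {1..n} = set (take k w)" if "k \<le> length w" for k
    using that
  proof (induction k)
    case 0
    then show ?case by (simp add: taken_def)
  next
    case (Suc k)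
    then have IH: "taken w k \<inter> {1..n} = set (take k w)" and k: "k < length w" by auto
    have wk: "w ! k \<in> {1..n}" using k set nth_mem by blast
    have "set_option (outcome w ! k) \<inter> {1..n} \<union> set (take k w) = insert (w ! k) (set (take k w))"
    proof (cases "w ! k \<in> set (take k w)")
      case False
      then have "w ! k \<notin> taken w k" using IH wk by blast
      then have "outcome w ! k = Some (w ! k)"
        using k wk n by (simp add: outcome_nth park_spot_self_iff)
      then show ?thesis using wk by simp
    next
      case True
      then obtain a where a: "a < k" "w ! a = w ! k"
        using k by (auto simp: in_set_take_conv_nth)
      \<comment> \<open>Position \<open>k\<close> repeats a letter, so no \<open>v\<close> at least
        that large occurs later. As \<open>v\<close> does occur, it has been read, and by
        \<open>IH\<close> its spot is occupied.\<close>
      have interval_taken: "v \<in> taken w k" if v: "w ! k \<le> v" "v \<le> n" for v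
      proof -
        have "v \<in> set w" using v wk set by auto
        then obtain c where c: "c < length w" "w ! c = v" by (auto simp: in_set_conv_nth)
        have "\<not> k < c" using D a c v unfolding descending_after_def by (metis not_less)
        then have "v \<in> set (take k w)"
        proof (cases "c = k")
          case False
          with \<open>\<not> k < c\<close> have "c < k" by simp
          with c k show ?thesis by (auto simp: in_set_take_conv_nth)
        qed (use c True in simp)
        then show ?thesis using IH by blast
      qed
      have "s > n" if "outcome w ! k = Some s" for s
      proof -
        have spot: "park_spot (length w) (taken w k) (w ! k) = Some s"
          using that k by (simp add: outcome_nth)
        show ?thesis
          using interval_taken[OF park_spot_eq_SomeD(1)[OF spot]] park_spot_eq_SomeD(3)[OF spot]
          by linarith
      qed
      then have "set_option (outcome w ! k) \<inter> {1..n} = {}" by fastforce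
      then show ?thesis using True by blast
    qed
    then show ?case using k IH by (simp add: taken_Suc take_Suc_conv_app_nth Int_Un_distrib2) blast
  qed
  have "first_cars w \<subseteq> lucky_cars w"
  proof
    fix k assume k: "k \<in> first_cars w"
    then have "w ! k \<notin> set (take k w)" by (auto simp: first_cars_def in_set_take_conv_nth)
    moreover have "w ! k \<in> {1..n}" using k set nth_mem[of k w] by (auto simp: first_cars_def)
    ultimately show "k \<in> lucky_cars w"
      using taken[of k] k n by (auto simp: first_cars_def lucky_cars_iff)
  qed
  then show ?thesis using lucky_cars_subset by blast
qed

subsection \<open>Extremely lucky Stirling permutations are the nested words\<close>

lemma count_twice:
  fixes n :: nat
  shows "count (\<Sum>i\<in>{1..n}. {#i, i#}) j = (if j \<in> {1..n} then 2 else 0)"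
proof -
  have "count {#i, i#} j = (if i = j then 2 else 0)" for i by simp
  then show ?thesis by (simp add: count_sum del: count_add_mset)
qed

lemma mset_eq_twice_iff:
  fixes n :: nat
  shows "mset w = (\<Sum>i\<in>{1..n}. {#i, i#}) \<longleftrightarrow>
    set w = {1..n} \<and> (\<forall>i\<in>set w. count_list w i = 2)"
proof -
  have "mset w = (\<Sum>i\<in>{1..n}. {#i, i#}) \<longleftrightarrow>
      (\<forall>j. count_list w j = (if j \<in> {1..n} then 2 else 0))"
    by (simp only: multiset_eq_iff count_twice count_mset)
  also have "\<dots> \<longleftrightarrow> set w = {1..n} \<and> (\<forall>i\<in>set w. count_list w i = 2)"
  proof
    assume *: "\<forall>j. count_list w j = (if j \<in> {1..n} then 2 else 0)"
    have "j \<in> set w \<longleftrightarrow> j \<in> {1..n}" for j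
      using *[rule_format, of j] count_list_0_iff[of w j]
      by (cases "j \<in> {1..n}") (simp_all del: atLeastAtMost_iff)
    then have "set w = {1..n}" by blast
    with * show "set w = {1..n} \<and> (\<forall>i\<in>set w. count_list w i = 2)" by simp
  next
    assume *: "set w = {1..n} \<and> (\<forall>i\<in>set w. count_list w i = 2)"
    show "\<forall>j. count_list w j = (if j \<in> {1..n} then 2 else 0)"
    proof
      fix j show "count_list w j = (if j \<in> {1..n} then 2 else 0)"
        using * count_list_0_iff[of w j]
        by (cases "j \<in> {1..n}") (simp_all del: atLeastAtMost_iff)
    qed
  qed
  finally show ?thesis .
qed

lemma split_twice:
  assumes "count_list w i = 2"
  obtains x y z where "w = x @ i # y @ i # z" "i \<notin> set x" "i \<notin> set y" "i \<notin> set z"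
proof -
  have "i \<in> set w" using assms by (metis count_list_0_iff zero_neq_numeral)
  then obtain x u where u: "w = x @ i # u" "i \<notin> set x" by (meson split_list_first)
  then have "count_list u i = 1" using assms by simp
  then have "i \<in> set u" by (metis count_list_0_iff zero_neq_one)
  then obtain y z where z: "u = y @ i # z" "i \<notin> set y" by (meson split_list_first)
  then have "i \<notin> set z" using \<open>count_list u i = 1\<close> by (simp add: count_list_0_iff)
  with u z that show thesis by simp
qed

lemma nested_iff:
  "nested w \<longleftrightarrow> (\<forall>i\<in>set w. count_list w i = 2) \<and> stirling_word w \<and> descending_after w"
proof (intro iffI conjI ballI)
  assume w: "nested w"
  show "count_list w i = 2" if i: "i \<in> set w" for i
  proof -
    obtain x y z where "w = x @ i # y @ i # z" "i \<notin> set x"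
        "\<forall>j\<in>set y. i < j" "\<forall>j\<in>set z. j < i"
      by (rule nestedE[OF w i]) (rule that)
    moreover from this have "i \<notin> set y" "i \<notin> set z" by blast+
    ultimately show ?thesis by simp
  qed
  \<comment> \<open>Passes from sublists to positions, since \<open>stirling_word\<close> and
    \<open>descending_after\<close> speak of indices.\<close>
  have pos: "\<exists>p q. {k. k < length w \<and> w ! k = i} = {p, q} \<and> p < q
      \<and> (\<forall>k. p < k \<longrightarrow> k < q \<longrightarrow> i < w ! k) \<and> (\<forall>k. q < k \<longrightarrow> k < length w \<longrightarrow> w ! k < i)"
    if i: "i \<in> set w" for i
  proof -
    obtain x y z where w: "w = x @ i # y @ i # z" "i \<notin> set x"
        "\<forall>j\<in>set y. i < j" "\<forall>j\<in>set z. j < i"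
      by (rule nestedE[OF w i]) (rule that)
    let ?p = "length x" and ?q = "length x + Suc (length y)"
    have x: "w ! k \<noteq> i" if "k < ?p" for k
      using w that nth_mem[of k x] by (auto simp: nth_append)
    have y: "i < w ! k" if k: "?p < k" "k < ?q" for k
    proof -
      obtain d where d: "k = Suc (?p + d)" using less_imp_Suc_add[OF k(1)] by blast
      then have "d < length y" using k(2) by simp
      moreover from this have "w ! k = y ! d" using w(1) d by (simp add: nth_append)
      ultimately show ?thesis using w(3) by simp
    qed
    have z: "w ! k < i" if k: "?q < k" "k < length w" for k
    proof -
      obtain d where d: "k = Suc (?q + d)" using less_imp_Suc_add[OF k(1)] by blast
      then have "d < length z" using k(2) w(1) by simp
      moreover from this have "w ! k = z ! d" using w(1) d by (simp add: nth_append)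
      ultimately show ?thesis using w(4) by simp
    qed
    have "w ! ?p = i" "w ! ?q = i" "?q < length w" using w by (simp_all add: nth_append)
    moreover have "k \<in> {?p, ?q}" if "k < length w" "w ! k = i" for k
      using x[of k] y[of k] z[of k] that by (metis insertCI less_irrefl linorder_neqE_nat)
    ultimately have "{k. k < length w \<and> w ! k = i} = {?p, ?q}" by auto
    moreover have "?p < ?q" by simp
    ultimately show ?thesis using y z by blast
  qed
  show "stirling_word w" unfolding stirling_word_def
  proof (intro allI impI)
    fix a b c assume abc: "a < b" "b < c" "c < length w" "w ! a = w ! c"
    obtain p q where pq: "{k. k < length w \<and> w ! k = w ! a} = {p, q}" "p < q"
        "\<forall>k. p < k \<longrightarrow> k < q \<longrightarrow> w ! a < w ! k"
      using pos[of "w ! a"] abc by auto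
    \<comment> \<open>The letter has only the positions \<open>p < q\<close>, so \<open>a\<close> is
      \<open>p\<close> and \<open>c\<close> is \<open>q\<close>.\<close>
    have "a \<in> {p, q}" "c \<in> {p, q}" using abc by (simp_all flip: pq(1))
    then show "w ! a < w ! b" using abc pq(2,3) by auto
  qed
  show "descending_after w" unfolding descending_after_def
  proof (intro allI impI)
    fix a b c assume abc: "a < b" "b < c" "c < length w" "w ! a = w ! b"
    obtain p q where pq: "{k. k < length w \<and> w ! k = w ! a} = {p, q}" "p < q"
        "\<forall>k. q < k \<longrightarrow> k < length w \<longrightarrow> w ! k < w ! a"
      using pos[of "w ! a"] abc by auto
    have "a \<in> {p, q}" "b \<in> {p, q}" using abc by (simp_all flip: pq(1))
    then show "w ! c < w ! a" using abc pq(2,3) by auto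
  qed
next
  assume w: "(\<forall>i\<in>set w. count_list w i = 2) \<and> stirling_word w \<and> descending_after w"
  show "nested w" unfolding nested_def
  proof
    fix i assume "i \<in> set w"
    then obtain x y z where xyz: "w = x @ i # y @ i # z" "i \<notin> set x" "i \<notin> set y" "i \<notin> set z"
      using w split_twice[of w i] by blast
    let ?p = "length x" and ?q = "length x + Suc (length y)"
    have pq: "w ! ?p = i" "w ! ?q = i" "?q < length w" using xyz by (simp_all add: nth_append)
    have "i < y ! k" if "k < length y" for k
    proof -
      have "w ! (Suc ?p + k) = y ! k" using that xyz by (simp add: nth_append)
      moreover have "w ! ?p < w ! (Suc ?p + k)"
        using w pq that unfolding stirling_word_def
        by (metis add_Suc_right add_less_cancel_left less_add_Suc1 add_Suc not_less_eq)
      ultimately show ?thesis using pq by simp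
    qed
    moreover have "z ! k < i" if "k < length z" for k
    proof -
      have "w ! (Suc ?q + k) = z ! k" using that xyz by (simp add: nth_append)
      moreover have "Suc ?q + k < length w" "?p < ?q" "?q < Suc ?q + k" using that xyz by auto
      then have "w ! (Suc ?q + k) < w ! ?p"
        using w pq unfolding descending_after_def by metis
      ultimately show ?thesis using pq by simp
    qed
    ultimately have "\<forall>j\<in>set y. i < j" "\<forall>j\<in>set z. j < i" by (auto simp: in_set_conv_nth)
    with xyz show "\<exists>x y z. w = x @ i # y @ i # z \<and> i \<notin> set x
      \<and> (\<forall>j\<in>set y. i < j) \<and> (\<forall>j\<in>set z. j < i)"
      by blast
  qed
qed

lemma extremely_lucky_eq: "extremely_lucky n = {w. nested w \<and> set w = {1..<1 + n}}"
proof (intro set_eqI)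
  fix w
  have lucky: "lucky w = n \<longleftrightarrow> descending_after w" if "set w = {1..n}" "stirling_word w"
  proof -
    have "n \<le> length w" using card_length[of w] that by simp
    moreover have "card (set w) = n" using that by simp
    ultimately show ?thesis
      using lucky_eq_iff[of w] descending_after_if_lucky[OF that]
        lucky_if_descending_after[OF that(1)] by metis
  qed
  have "w \<in> extremely_lucky n \<longleftrightarrow>
      set w = {1..n} \<and> (\<forall>i\<in>set w. count_list w i = 2) \<and> stirling_word w \<and> lucky w = n"
    unfolding extremely_lucky_def stirling_perms_def mset_eq_twice_iff stirling_word_def by blast
  also have "\<dots> \<longleftrightarrow> nested w \<and> set w = {1..n}"
    using lucky nested_iff by blast
  \<comment> \<open>The half-open form matches \<open>bij_betw_word\<close> with
    \<open>m = 1\<close>.\<close>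
  also have "{1..n} = {1..<1 + n}" by auto
  finally show "w \<in> extremely_lucky n \<longleftrightarrow> w \<in> {w. nested w \<and> set w = {1..<1 + n}}" by simp
qed

theorem theorem2p14:
  fixes n :: nat
  assumes "n > 0"
  shows "\<exists>f. bij_betw f (extremely_lucky n) (valid_parens n)"
proof -
  have "bij_betw (word 1) {t. size t = n} (extremely_lucky n)"
    unfolding extremely_lucky_eq by (rule bij_betw_word)
  then have "bij_betw (parens \<circ> inv_into {t. size t = n} (word 1)) (extremely_lucky n) (valid_parens n)"
    using bij_betw_inv_into bij_betw_trans bij_betw_parens by blast
  then show ?thesis by blast
qed

end
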